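(* It is not true that the LCM matrix of every odd GCD closed set is nonsingular. That is, there exists a finite GCD closed set $S=\{x_1,\ldots,x_n\}$ of distinct odd positive integers such that the LCM matrix $[S]$, i.e. the $n\times n$ matrix whose $(i,j)$-entry is $\mathrm{lcm}(x_i,x_j)$, is singular.
   Context: A finite set $S$ of positive integers is GCD closed if $\gcd(a,b)\in S$ for all $a,b\in S$. A set is odd if all its elements are odd. *)

theory Defs
  imports Complex_Main "Jordan_Normal_Form.Matrix"
begin

definition gcd_closed :: "nat set \<Rightarrow> bool" where
  "gcd_closed S \<longleftrightarrow> (\<forall>a\<in>S. \<forall>b\<in>S. gcd a b \<in> S)"

definition odd_set :: "nat set \<Rightarrow> bool" where
  "odd_set S \<longleftrightarrow> (\<forall>a\<in>S. odd a)"

(* The list xs fixes the enumeration x_1, ..., x_n of the set. The entries are real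
   so that invertibility is meant over a field, not over the integers. *)
definition lcm_matrix :: "nat list \<Rightarrow> real mat" where
  "lcm_matrix xs =
     mat (length xs) (length xs) (\<lambda>(i, j). real (lcm (xs ! i) (xs ! j)))"

definition singular_mat :: "real mat \<Rightarrow> bool" where
  "singular_mat A \<longleftrightarrow> square_mat A \<and> \<not> invertible_mat A"

end

theory Submission
  imports Defs
begin

text \<open>For a GCD closed set with maximum T divisible by all its elements, Moebius inversion on the
  meet semilattice shows that the vector with entries \<mu>(x, T) / x is annihilated by every row of the
  LCM matrix other than the one of T, and the remaining row gives the single condition that the sum
  of \<mu>(x, T) / x vanishes. The set {1, 5, 7, 19, 67, 7 * 19, 7 * 67, 19 * 67, 5 * 7 * 19 * 67}
  satisfies it. Besides T, only the maximal proper elements 5, 7 * 19, 7 * 67, 19 * 67 and the GCDs 7, 19, 67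
  contribute, since \<mu>(1, T) = 0.\<close>

text \<open>A left inverse \<open>B\<close> would give v = B (A v) = 0.\<close>

lemma singular_matI:
  assumes A: "A \<in> carrier_mat n n" and v: "v \<in> carrier_vec n"
    and nz: "v \<noteq> 0\<^sub>v n" and ker: "A *\<^sub>v v = 0\<^sub>v n"
  shows "singular_mat A"
proof -
  have False if "invertible_mat A"
  proof -
    from that obtain B where AB: "A * B = 1\<^sub>m (dim_row A)" and BA: "B * A = 1\<^sub>m (dim_row B)"
      unfolding invertible_mat_def inverts_mat_def by blast
    \<comment> \<open>\<open>invertible_mat\<close> leaves the shape of \<open>B\<close> open;
      comparing column counts in the two identities settles it.\<close>
    have "dim_col B = n"
      using A arg_cong[OF AB, of dim_col] by simp
    moreover have "dim_row B = n"
      using A arg_cong[OF BA, of dim_col] by simp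
    ultimately have B: "B \<in> carrier_mat n n"
      by (intro carrier_matI)
    have "v = (B * A) *\<^sub>v v" unfolding BA using B v by simp
    also have "\<dots> = B *\<^sub>v (A *\<^sub>v v)" by (rule assoc_mult_mat_vec[OF B A v])
    also have "\<dots> = 0\<^sub>v n" unfolding ker using B by (intro eq_vecI) auto
    finally show False using nz by simp
  qed
  then show ?thesis using A by (auto simp: singular_mat_def)
qed

definition singular_example :: "nat list" where
  "singular_example = [1, 5, 7, 19, 67, 133, 469, 1273, 44555]"

text \<open>The entries of the kernel vector are \<mu>(x, T) * T / x with T = 44555.\<close>

lemma singular_lcm_matrix_example: "singular_mat (lcm_matrix singular_example)"
proof (rule singular_matI)
  let ?w = "[0, - 8911, 6365, 2345, 665, - 335, - 95, - 35, 1] :: real list"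
  let ?v = "vec 9 (\<lambda>j. ?w ! j)"
  have len: "length singular_example = 9"
    by (simp add: singular_example_def)
  show "lcm_matrix singular_example \<in> carrier_mat 9 9"
    unfolding lcm_matrix_def len by (rule mat_carrier)
  show "?v \<in> carrier_vec 9"
    by simp
  \<comment> \<open>The entry at T is \<mu>(T, T) = 1.\<close>
  have "?v $ 8 \<noteq> 0\<^sub>v 9 $ 8"
    by simp
  then show "?v \<noteq> 0\<^sub>v 9"
    by (rule contrapos_nn) simp
  \<comment> \<open>With the index set written out, each of the nine row sums expands into
    numerals.\<close>
  have orthogonal: "\<forall>x\<in>set singular_example.
      (\<Sum>j\<in>{0, 1, 2, 3, 4, 5, 6, 7, 8}. real (lcm x (singular_example ! j)) * ?w ! j) = 0"
    by (simp add: singular_example_def lcm_nat_def gcd_non_0_nat)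
  have indices: "{0..<9} = {0, 1, 2, 3, 4, 5, 6, 7, 8 :: nat}"
    by auto
  show "lcm_matrix singular_example *\<^sub>v ?v = 0\<^sub>v 9"
  proof (rule eq_vecI)
    fix i assume "i < dim_vec (0\<^sub>v 9 :: real vec)"
    then have i: "i < 9" by simp
    have "(lcm_matrix singular_example *\<^sub>v ?v) $ i =
        (\<Sum>j\<in>{0..<9}. real (lcm (singular_example ! i) (singular_example ! j)) * ?w ! j)"
      unfolding lcm_matrix_def len using i
      by (simp only: index_mult_mat_vec dim_row_mat scalar_prod_def dim_vec)
        (intro sum.cong refl, simp)
    also have "\<dots> = 0"
      unfolding indices by (rule orthogonal[rule_format]) (simp add: i len)
    finally show "(lcm_matrix singular_example *\<^sub>v ?v) $ i = 0\<^sub>v 9 $ i"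
      using i by simp
  qed (simp add: lcm_matrix_def len)
qed

theorem theorem4p2:
  "\<exists>(S :: nat set) (xs :: nat list).
     finite S \<and> (\<forall>a\<in>S. 0 < a) \<and> gcd_closed S \<and> odd_set S \<and>
     distinct xs \<and> set xs = S \<and> singular_mat (lcm_matrix xs)"
proof (intro exI conjI)
  \<comment> \<open>A finite check over pairs, with \<open>gcd_non_0_nat\<close> as the step of
    Euclid's algorithm.\<close>
  show "gcd_closed (set singular_example)"
    by (simp add: gcd_closed_def singular_example_def gcd_non_0_nat)
  show "singular_mat (lcm_matrix singular_example)"
    by (rule singular_lcm_matrix_example)
qed (simp_all add: singular_example_def odd_set_def)

end
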